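(* Let $X$ be an $H$-closed topological pospace such that (i) $X$ is regularly ordered; (ii) $X$ is a $CC_i$-space; and (iii) $X$ is a $CC_d$-space. Then every maximal chain in $X$ with the ${\updownarrow}{\cdot}\operatorname{m}$-property is an $H$-closed topological pospace (with the subspace topology and the induced order).
   Context: All topological spaces are Hausdorff. A topological pospace is a topological space $X$ equipped with a continuous (closed) partial order $\leqslant$, i.e. one whose graph is closed in $X\times X$. A topological pospace $X$ is $H$-closed if $X$ is a closed subspace of every Hausdorff topological pospace in which it is contained (as a subspace with the induced order). A chain is a subset linearly ordered by the partial order; a maximal chain is a chain properly contained in no other chain. For $A\subseteq X$, ${\uparrow}A=\{y\in X\mid x\leqslant y\text{ for some }x\in A\}$ and ${\downarrow}A=\{y\in X\mid y\leqslant x\text{ for some }x\in A\}$, with ${\uparrow}a={\uparrow}\{a\}$, ${\downarrow}a={\downarrow}\{a\}$; $A$ is increasing if $A={\uparrow}A$ and decreasing if $A={\downarrow}A$. A topological pospace $X$ is upper (resp. lower) regularly ordered if for each closed increasing (resp. decreasing) subset $F$ of $X$ and each $a\notin F$ there exist disjoint open neighbourhoods $U$ of $a$ and $V$ of $F$ such that $U$ is decreasing (resp. increasing) and $V$ is increasing (resp. decreasing) in $X$. $X$ is regularly ordered if it is both upper and lower regularly ordered. $X$ is a $CC_i$-space (resp. $CC_d$-space) if whenever a chain $F$ of $X$ is closed, ${\uparrow}F$ (resp. ${\downarrow}F$) is a closed subset of $X$. A chain $L$ of a partially ordered set $P$ has the ${\downarrow}{\cdot}\max$-property (resp. ${\uparrow}{\cdot}\min$-property)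 in $P$ if for every $a\in P$ such that ${\downarrow}a\cap L\neq\varnothing$ (resp. ${\uparrow}a\cap L\neq\varnothing$) the chain ${\downarrow}a\cap L$ (resp. ${\uparrow}a\cap L$) has a maximal (resp. minimal) element. $L$ has the ${\updownarrow}{\cdot}\operatorname{m}$-property if it has both the ${\downarrow}{\cdot}\max$- and the ${\uparrow}{\cdot}\min$-property. *)

theory Defs
  imports "HOL-Analysis.Analysis"
begin

text \<open>
  A topological pospace is a pair of a topology \<open>X\<close> and an order relation \<open>r\<close> on its carrier.
  Since \<^const>\<open>partial_order_on\<close> includes \<open>r \<subseteq> topspace X \<times> topspace X\<close>, the relation \<open>r\<close> is
  the graph of the order, the up-set and the down-set of \<open>A\<close> are \<open>r `` A\<close> and \<open>r\<inverse> `` A\<close>, and the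
  chains are exactly the members of \<^term>\<open>Chains r\<close>.
\<close>

definition pospace :: "'a topology \<Rightarrow> 'a rel \<Rightarrow> bool" where
  "pospace X r \<longleftrightarrow>
     Hausdorff_space X \<and> partial_order_on (topspace X) r \<and> closedin (prod_topology X X) r"

text \<open>
  Containment as a subspace with the induced order, up to renaming of points.
\<close>

definition pospace_embedding ::
  "'a topology \<Rightarrow> 'a rel \<Rightarrow> 'b topology \<Rightarrow> 'b rel \<Rightarrow> ('a \<Rightarrow> 'b) \<Rightarrow> bool" where
  "pospace_embedding X r Y s f \<longleftrightarrow>
     embedding_map X Y f \<and>
     (\<forall>x\<in>topspace X. \<forall>y\<in>topspace X. (f x, f y) \<in> s \<longleftrightarrow> (x, y) \<in> r)"

text \<open>
  H-closedness relative to extensions whose points are taken from the type \<open>'b\<close>, because HOL cannot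
  quantify over all types inside a definition. The type \<open>'a option\<close> is large enough: by the lemma
  \<open>H_closed_pospace_universal\<close> below, H-closedness relative to \<open>'a option\<close> implies
  H-closedness relative to every type, so it is H-closedness in the unrestricted sense.
\<close>

definition H_closed_pospace :: "'b itself \<Rightarrow> 'a topology \<Rightarrow> 'a rel \<Rightarrow> bool" where
  "H_closed_pospace T X r \<longleftrightarrow>
     pospace X r \<and>
     (\<forall>(Y :: 'b topology) s f.
        pospace Y s \<and> pospace_embedding X r Y s f \<longrightarrow> closedin Y (f ` topspace X))"

definition increasing_in :: "'a rel \<Rightarrow> 'a set \<Rightarrow> bool" where
  "increasing_in r A \<longleftrightarrow> A = r `` A"

definition decreasing_in :: "'a rel \<Rightarrow> 'a set \<Rightarrow> bool" where
  "decreasing_in r A \<longleftrightarrow> A = r\<inverse> `` A"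

definition upper_regularly_ordered :: "'a topology \<Rightarrow> 'a rel \<Rightarrow> bool" where
  "upper_regularly_ordered X r \<longleftrightarrow>
     (\<forall>F a. closedin X F \<and> increasing_in r F \<and> a \<in> topspace X - F \<longrightarrow>
        (\<exists>U V. openin X U \<and> openin X V \<and> a \<in> U \<and> F \<subseteq> V \<and> disjnt U V \<and>
           decreasing_in r U \<and> increasing_in r V))"

definition lower_regularly_ordered :: "'a topology \<Rightarrow> 'a rel \<Rightarrow> bool" where
  "lower_regularly_ordered X r \<longleftrightarrow>
     (\<forall>F a. closedin X F \<and> decreasing_in r F \<and> a \<in> topspace X - F \<longrightarrow>
        (\<exists>U V. openin X U \<and> openin X V \<and> a \<in> U \<and> F \<subseteq> V \<and> disjnt U V \<and>
           increasing_in r U \<and> decreasing_in r V))"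

definition regularly_ordered :: "'a topology \<Rightarrow> 'a rel \<Rightarrow> bool" where
  "regularly_ordered X r \<longleftrightarrow> upper_regularly_ordered X r \<and> lower_regularly_ordered X r"

definition CC_i_space :: "'a topology \<Rightarrow> 'a rel \<Rightarrow> bool" where
  "CC_i_space X r \<longleftrightarrow> (\<forall>F\<in>Chains r. closedin X F \<longrightarrow> closedin X (r `` F))"

definition CC_d_space :: "'a topology \<Rightarrow> 'a rel \<Rightarrow> bool" where
  "CC_d_space X r \<longleftrightarrow> (\<forall>F\<in>Chains r. closedin X F \<longrightarrow> closedin X (r\<inverse> `` F))"

definition maximal_chain :: "'a rel \<Rightarrow> 'a set \<Rightarrow> bool" where
  "maximal_chain r L \<longleftrightarrow> L \<in> Chains r \<and> \<not> (\<exists>C\<in>Chains r. L \<subset> C)"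

definition maximal_element :: "'a rel \<Rightarrow> 'a set \<Rightarrow> 'a \<Rightarrow> bool" where
  "maximal_element r S m \<longleftrightarrow> m \<in> S \<and> (\<forall>x\<in>S. (m, x) \<in> r \<longrightarrow> x = m)"

definition minimal_element :: "'a rel \<Rightarrow> 'a set \<Rightarrow> 'a \<Rightarrow> bool" where
  "minimal_element r S m \<longleftrightarrow> m \<in> S \<and> (\<forall>x\<in>S. (x, m) \<in> r \<longrightarrow> x = m)"

text \<open>In the following three definitions \<open>P\<close> is the carrier of the partially ordered set.\<close>

definition down_max_property :: "'a set \<Rightarrow> 'a rel \<Rightarrow> 'a set \<Rightarrow> bool" where
  "down_max_property P r L \<longleftrightarrow>
     (\<forall>a\<in>P. r\<inverse> `` {a} \<inter> L \<noteq> {} \<longrightarrow> (\<exists>m. maximal_element r (r\<inverse> `` {a} \<inter> L) m))"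

definition up_min_property :: "'a set \<Rightarrow> 'a rel \<Rightarrow> 'a set \<Rightarrow> bool" where
  "up_min_property P r L \<longleftrightarrow>
     (\<forall>a\<in>P. r `` {a} \<inter> L \<noteq> {} \<longrightarrow> (\<exists>m. minimal_element r (r `` {a} \<inter> L) m))"

definition updown_m_property :: "'a set \<Rightarrow> 'a rel \<Rightarrow> 'a set \<Rightarrow> bool" where
  "updown_m_property P r L \<longleftrightarrow> down_max_property P r L \<and> up_min_property P r L"

text \<open>
  If \<open>X\<close> is not closed in an extension \<open>Y\<close>, then it is not closed in the subspace of \<open>Y\<close> obtained by
  adding a single point of its closure, and that subspace can be modelled on \<open>'a option\<close>.
\<close>

lemma H_closed_pospace_universal:
  fixes X :: "'a topology" and r :: "'a rel"
  assumes H: "H_closed_pospace TYPE('a option) X r"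
  shows "H_closed_pospace TYPE('b) X r"
  unfolding H_closed_pospace_def
proof (intro conjI allI impI)
  show "pospace X r" using H by (simp add: H_closed_pospace_def)
next
  fix Y :: "'b topology" and s :: "'b rel" and f :: "'a \<Rightarrow> 'b"
  assume "pospace Y s \<and> pospace_embedding X r Y s f"
  then have haus: "Hausdorff_space Y" and po: "partial_order_on (topspace Y) s"
    and cl: "closedin (prod_topology Y Y) s" and emb: "embedding_map X Y f"
    and ord: "\<And>x y. x \<in> topspace X \<Longrightarrow> y \<in> topspace X \<Longrightarrow> (f x, f y) \<in> s \<longleftrightarrow> (x, y) \<in> r"
    by (auto simp: pospace_def pospace_embedding_def)
  have inj: "inj_on f (topspace X)" and contf: "continuous_map X Y f"
    using homeomorphic_imp_injective_map homeomorphic_imp_continuous_map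
      emb [unfolded embedding_map_def]
    by (blast, blast intro: continuous_map_into_fulltopology)
  have fX: "f ` topspace X \<subseteq> topspace Y"
    using contf by (auto simp: continuous_map_def)
  show "closedin Y (f ` topspace X)"
  proof (rule ccontr)
    assume "\<not> closedin Y (f ` topspace X)"
    then obtain y where y: "y \<in> Y closure_of (f ` topspace X)" "y \<notin> f ` topspace X"
      using closure_of_subset_eq fX by blast
    have yY: "y \<in> topspace Y" using y(1) by (simp add: in_closure_of)
    define g where "g = case_option y f"
    have g_simps [simp]: "g None = y" "\<And>x. g (Some x) = f x" by (simp_all add: g_def)
    define A where "A = insert None (Some ` topspace X)"
    define Z where "Z = pullback_topology A g Y"
    define t where "t = {p \<in> A \<times> A. (g (fst p), g (snd p)) \<in> s}"
    have gA: "g ` A \<subseteq> topspace Y" using fX yY by (auto simp: A_def)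
    have top: "topspace Z = A" using gA by (auto simp: Z_def topspace_pullback_topology)
    have injg: "inj_on g A" using inj y(2) by (auto simp: A_def inj_on_def)
    have contg: "continuous_map Z Y g"
      unfolding Z_def using continuous_map_pullback [of Y Y id A g] by simp
    have hausZ: "Hausdorff_space Z"
      using Hausdorff_space_injective_preimage [OF haus contg] injg top by simp
    have poZ: "partial_order_on A t"
    proof -
      have "refl_on A t" using po gA by (auto simp: order_on_defs refl_on_def t_def)
      moreover have "trans t"
        using partial_order_onD(2) [OF po] unfolding trans_def t_def by fastforce
      moreover have "antisym t"
        using partial_order_onD(3) [OF po] injg unfolding antisym_def t_def inj_on_def by fastforce
      ultimately show ?thesis by (auto simp: order_on_defs t_def)
    qed
    have "continuous_map (prod_topology Z Z) (prod_topology Y Y) (\<lambda>p. (g (fst p), g (snd p)))"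
      using continuous_map_compose [OF continuous_map_fst contg]
        continuous_map_compose [OF continuous_map_snd contg]
      by (intro continuous_map_pairedI) (simp_all add: o_def)
    from closedin_continuous_map_preimage [OF this cl]
    have clZ: "closedin (prod_topology Z Z) t" by (simp add: t_def top)
    have posZ: "pospace Z t"
      using hausZ poZ clZ by (simp add: pospace_def top)
    have contS: "continuous_map X Z Some"
      unfolding Z_def using contf
      by (intro continuous_map_pullback') (auto simp: o_def A_def)
    have openS: "openin (subtopology Z (Some ` topspace X)) (Some ` U)" if U: "openin X U" for U
    proof -
      have UX: "U \<subseteq> topspace X" using U by (rule openin_subset)
      have "open_map X (subtopology Y (f ` topspace X)) f"
        using emb unfolding embedding_map_def by (rule homeomorphic_imp_open_map)
      then have "openin (subtopology Y (f ` topspace X)) (f ` U)" using U by (auto simp: open_map_def)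
      then obtain W where W: "openin Y W" "f ` U = W \<inter> f ` topspace X"
        by (auto simp: openin_subtopology)
      have "Some ` U = (g -` W \<inter> A) \<inter> Some ` topspace X"
      proof (intro equalityI subsetI)
        fix z assume "z \<in> Some ` U"
        then show "z \<in> (g -` W \<inter> A) \<inter> Some ` topspace X" using W(2) UX by (auto simp: A_def)
      next
        fix z assume "z \<in> (g -` W \<inter> A) \<inter> Some ` topspace X"
        then obtain x where x: "z = Some x" "x \<in> topspace X" "f x \<in> W" by auto
        then have "f x \<in> f ` U" using W(2) by auto
        then have "x \<in> U" using inj x(2) UX by (auto simp: inj_on_def)
        then show "z \<in> Some ` U" using x(1) by simp
      qed
      moreover have "openin Z (g -` W \<inter> A)"
        unfolding Z_def openin_pullback_topology using W(1) by blast
      ultimately show ?thesis unfolding openin_subtopology by blast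
    qed
    have "embedding_map X Z Some"
      unfolding embedding_map_def
    proof (rule bijective_open_imp_homeomorphic_map)
      show "continuous_map X (subtopology Z (Some ` topspace X)) Some"
        using contS by (simp add: continuous_map_in_subtopology)
      show "open_map X (subtopology Z (Some ` topspace X)) Some"
        using openS by (simp add: open_map_def)
      show "Some ` topspace X = topspace (subtopology Z (Some ` topspace X))"
        by (auto simp: top A_def)
    qed simp
    then have "pospace_embedding X r Z t Some"
      using ord by (auto simp: pospace_embedding_def t_def A_def)
    then have "closedin Z (Some ` topspace X)"
      using H posZ by (auto simp: H_closed_pospace_def)
    then have "openin Z (topspace Z - Some ` topspace X)" by (simp add: closedin_def)
    moreover have "topspace Z - Some ` topspace X = {None}" unfolding top A_def by blast
    ultimately obtain U where U: "openin Y U" "{None} = g -` U \<inter> A"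
      unfolding Z_def openin_pullback_topology by metis
    have "y \<in> U" using equalityD1 [OF U(2)] by simp
    then obtain x where "x \<in> topspace X" "f x \<in> U"
      using y(1) U(1) by (auto simp: in_closure_of)
    then have "Some x \<in> {None}" unfolding U(2) by (simp add: A_def)
    then show False by simp
  qed
qed

end

theory Submission
  imports Defs
begin

text \<open>
  The heart of the matter is that \<open>X\<close> has no gaps: if \<open>A\<close> is a nonempty chain of \<open>X\<close> whose down-set
  is closed, then \<open>A\<close> has a greatest element (\<open>chain_has_greatest\<close>). Otherwise a new point \<open>\<infinity>\<close> can be
  placed immediately above \<open>A\<close>, that is, above the down-set of \<open>A\<close> and below every upper bound of \<open>A\<close>.
  This is antisymmetric because no upper bound of \<open>A\<close> lies in the down-set of \<open>A\<close>. As neighbourhoods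
  of \<open>\<infinity>\<close> one takes the sets that contain \<open>D \<inter> I\<close>, where \<open>D\<close> is an open decreasing set containing \<open>A\<close>
  and \<open>I\<close> is an open increasing set meeting \<open>A\<close>. Regularity makes the extended order closed: the sets
  \<open>D\<close> separate \<open>\<infinity>\<close> from a point outside the closed decreasing set generated by \<open>A\<close>, and the sets \<open>I\<close>
  separate \<open>\<infinity>\<close> from a point that fails to be above some \<open>a \<in> A\<close>. Each \<open>D \<inter> I\<close> contains a final
  segment of \<open>A\<close>, so \<open>\<infinity>\<close> lies in the closure of \<open>X\<close>, contradicting H-closedness.

  The conditions \<open>CC\<^sub>d\<close> and \<open>CC\<^sub>i\<close> say that the above applies to every closed chain of \<open>X\<close> and, after
  reversing the order, that every nonempty closed chain also has a least element.

  Now let a maximal chain \<open>L\<close> be embedded by \<open>f\<close> in a pospace \<open>Y\<close>, and let \<open>y\<close> be a point of the closure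
  of the image of \<open>L\<close>. Being comparable to a fixed point is a closed condition, so \<open>L\<close> splits into the
  part \<open>A\<close> mapped below \<open>y\<close> and the part \<open>B\<close> mapped above \<open>y\<close>. Both are closed in \<open>L\<close>, hence in \<open>X\<close>, as
  maximal chains are closed. The point \<open>y\<close> is in the closure of the image of \<open>A\<close> or of \<open>B\<close>. In the
  first case the greatest element \<open>m\<close> of \<open>A\<close> satisfies \<open>f m \<le> y\<close> and, by closedness of the order,
  \<open>y \<le> f m\<close>; so \<open>y = f m\<close> is in the image. The second case is dual.
\<close>

section \<open>Topological pospaces\<close>

lemma pospace_refl: "pospace X r \<Longrightarrow> x \<in> topspace X \<Longrightarrow> (x, x) \<in> r"
  by (auto simp: pospace_def order_on_defs refl_on_def)

lemma pospace_trans: "pospace X r \<Longrightarrow> (x, y) \<in> r \<Longrightarrow> (y, z) \<in> r \<Longrightarrow> (x, z) \<in> r"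
  unfolding pospace_def by (meson partial_order_onD(2) transD)

lemma pospace_antisym: "pospace X r \<Longrightarrow> (x, y) \<in> r \<Longrightarrow> (y, x) \<in> r \<Longrightarrow> x = y"
  unfolding pospace_def by (meson partial_order_onD(3) antisymD)

lemma pospace_carrier:
  assumes "pospace X r" "(x, y) \<in> r"
  shows "x \<in> topspace X" "y \<in> topspace X"
  using assms closedin_subset [of "prod_topology X X" r] by (auto simp: pospace_def)

lemma pospace_separate:
  assumes "pospace X r" "x \<in> topspace X" "y \<in> topspace X" "(x, y) \<notin> r"
  obtains U V where "openin X U" "openin X V" "x \<in> U" "y \<in> V" "U \<times> V \<inter> r = {}"
proof -
  have "openin (prod_topology X X) (topspace X \<times> topspace X - r)"
    using assms(1) by (auto simp: pospace_def closedin_def)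
  moreover have "(x, y) \<in> topspace X \<times> topspace X - r" using assms by simp
  ultimately obtain U V where UV: "openin X U" "openin X V" "x \<in> U" "y \<in> V"
      "U \<times> V \<subseteq> topspace X \<times> topspace X - r"
    unfolding openin_prod_topology_alt by meson
  from UV(5) have "U \<times> V \<inter> r = {}" by blast
  with UV(1-4) show thesis by (rule that)
qed

text \<open>
  The Hausdorff axiom comes for free from a closed partial order: if \<open>x \<noteq> y\<close>, one of \<open>(x, y)\<close> and
  \<open>(y, x)\<close> is outside the graph, and a box around it that misses the graph misses the diagonal.
\<close>

lemma pospaceI:
  assumes po: "partial_order_on (topspace X) r"
    and r: "r \<subseteq> topspace X \<times> topspace X"
    and sep: "\<And>x y. x \<in> topspace X \<Longrightarrow> y \<in> topspace X \<Longrightarrow> (x, y) \<notin> r \<Longrightarrow>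
      \<exists>U V. openin X U \<and> openin X V \<and> x \<in> U \<and> y \<in> V \<and> U \<times> V \<inter> r = {}"
  shows "pospace X r"
proof -
  have disj: "disjnt U V" if "openin X U" "U \<times> V \<inter> r = {}" for U V
    using po that openin_subset [of X U]
    by (fastforce simp: order_on_defs refl_on_def disjnt_iff)
  have "Hausdorff_space X"
    unfolding Hausdorff_space_def
  proof (intro allI impI)
    fix x y assume xy: "x \<in> topspace X \<and> y \<in> topspace X \<and> x \<noteq> y"
    then consider "(x, y) \<notin> r" | "(y, x) \<notin> r"
      using partial_order_onD(3) [OF po] by (auto simp: antisym_def)
    then show "\<exists>U V. openin X U \<and> openin X V \<and> x \<in> U \<and> y \<in> V \<and> disjnt U V"
    proof cases
      case 1
      then show ?thesis using sep [of x y] xy disj by blast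
    next
      case 2
      then show ?thesis using sep [of y x] xy disj by (meson disjnt_sym)
    qed
  qed
  moreover have "openin (prod_topology X X) (topspace X \<times> topspace X - r)"
    unfolding openin_prod_topology_alt
  proof (intro allI impI)
    fix x y assume "(x, y) \<in> topspace X \<times> topspace X - r"
    then obtain U V where UV: "openin X U" "openin X V" "x \<in> U" "y \<in> V" "U \<times> V \<inter> r = {}"
      using sep [of x y] by blast
    then have "U \<times> V \<subseteq> topspace X \<times> topspace X - r"
      using openin_subset [of X U] openin_subset [of X V] by blast
    with UV show "\<exists>U V. openin X U \<and> openin X V \<and> x \<in> U \<and> y \<in> V \<and>
        U \<times> V \<subseteq> topspace X \<times> topspace X - r"
      by blast
  qed
  ultimately show ?thesis
    using po r by (simp add: pospace_def closedin_def)
qed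

lemma pospace_converse:
  assumes P: "pospace X r"
  shows "pospace X (r\<inverse>)"
proof (rule pospaceI)
  show "partial_order_on (topspace X) (r\<inverse>)" using P by (simp add: pospace_def)
  show "r\<inverse> \<subseteq> topspace X \<times> topspace X" using pospace_carrier [OF P] by auto
  fix x y assume "x \<in> topspace X" "y \<in> topspace X" "(x, y) \<notin> r\<inverse>"
  then obtain U V where "openin X U" "openin X V" "y \<in> U" "x \<in> V" "U \<times> V \<inter> r = {}"
    using pospace_separate [OF P, of y x] by auto
  then show "\<exists>U V. openin X U \<and> openin X V \<and> x \<in> U \<and> y \<in> V \<and> U \<times> V \<inter> r\<inverse> = {}"
    by (intro exI [of _ V] exI [of _ U]) auto
qed

lemma pospace_subtopology:
  assumes P: "pospace X r" and L: "L \<subseteq> topspace X"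
  shows "pospace (subtopology X L) (r \<inter> L \<times> L)"
proof -
  have top: "topspace (subtopology X L) = L" using L by auto
  have "refl_on L (r \<inter> L \<times> L)"
    using pospace_refl [OF P] L by (auto simp: refl_on_def)
  moreover have "trans (r \<inter> L \<times> L)"
    by (rule transI) (use pospace_trans [OF P] in blast)
  moreover have "antisym (r \<inter> L \<times> L)"
    by (rule antisymI) (use pospace_antisym [OF P] in blast)
  ultimately have "partial_order_on L (r \<inter> L \<times> L)"
    by (simp add: order_on_defs)
  moreover have "closedin (prod_topology (subtopology X L) (subtopology X L)) (r \<inter> L \<times> L)"
    using P unfolding subtopology_Times [symmetric] closedin_subtopology pospace_def by blast
  ultimately show ?thesis
    using P unfolding pospace_def top by (simp add: Hausdorff_space_subtopology)
qed

lemma closedin_up_point: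
  assumes P: "pospace X r"
  shows "closedin X (r `` {a})"
proof (cases "a \<in> topspace X")
  case True
  then have "continuous_map X (prod_topology X X) (\<lambda>x. (a, x))"
    by (intro continuous_map_pairedI) auto
  moreover have "closedin (prod_topology X X) r" using P by (simp add: pospace_def)
  ultimately have "closedin X {x \<in> topspace X. (a, x) \<in> r}"
    by (rule closedin_continuous_map_preimage)
  moreover have "{x \<in> topspace X. (a, x) \<in> r} = r `` {a}" using pospace_carrier [OF P] by auto
  ultimately show ?thesis by simp
next
  case False
  then have "r `` {a} = {}" using pospace_carrier [OF P] by auto
  then show ?thesis by simp
qed

lemma closedin_down_point: "pospace X r \<Longrightarrow> closedin X (r\<inverse> `` {a})"
  using closedin_up_point [OF pospace_converse] .

lemma chain_subset_topspace: "pospace X r \<Longrightarrow> C \<in> Chains r \<Longrightarrow> C \<subseteq> topspace X"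
  by (auto simp: Chains_def dest: pospace_carrier)

lemma chain_subset: "C \<in> Chains r \<Longrightarrow> D \<subseteq> C \<Longrightarrow> D \<in> Chains r"
  unfolding Chains_def by blast

lemma Chains_converse: "Chains (r\<inverse>) = Chains r"
  unfolding Chains_def by auto

text \<open>
  A limit point of a chain is comparable to all its members, because the points comparable to a given
  one form a closed set; so it can be added to the chain.
\<close>

lemma closedin_maximal_chain:
  assumes P: "pospace X r" and L: "maximal_chain r L"
  shows "closedin X L"
proof -
  have ch: "L \<in> Chains r" and mx: "\<And>C. C \<in> Chains r \<Longrightarrow> \<not> L \<subset> C"
    using L by (auto simp: maximal_chain_def)
  have LX: "L \<subseteq> topspace X" by (rule chain_subset_topspace [OF P ch])
  have "X closure_of L \<subseteq> L"
  proof
    fix x assume x: "x \<in> X closure_of L"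
    then have xX: "x \<in> topspace X" by (simp add: in_closure_of)
    have "(l, x) \<in> r \<or> (x, l) \<in> r" if l: "l \<in> L" for l
    proof -
      have "X closure_of L \<subseteq> r `` {l} \<union> r\<inverse> `` {l}"
      proof (rule closure_of_minimal)
        show "L \<subseteq> r `` {l} \<union> r\<inverse> `` {l}" using ch l unfolding Chains_def by blast
        show "closedin X (r `` {l} \<union> r\<inverse> `` {l})"
          by (intro closedin_Un closedin_up_point closedin_down_point P)
      qed
      then show ?thesis using x by auto
    qed
    then have "insert x L \<in> Chains r"
      using ch pospace_refl [OF P xX] unfolding Chains_def by blast
    then show "x \<in> L" using mx [of "insert x L"] by blast
  qed
  then show ?thesis using closure_of_subset_eq [of L X] LX by blast
qed

section \<open>Adjoining a supremum to a chain\<close>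

text \<open>
  The new point \<open>\<infinity>\<close> is \<^const>\<open>None\<close>. It lies below all upper bounds of \<open>A\<close>, so that in the extended
  order it is the supremum of \<open>A\<close>.
\<close>

definition sup_order :: "'a rel \<Rightarrow> 'a set \<Rightarrow> 'a option rel" where
  "sup_order r A =
     (\<lambda>(x, y). (Some x, Some y)) ` r \<union> (Some ` (r\<inverse> `` A)) \<times> {None} \<union>
     {None} \<times> (Some ` {x. \<forall>a\<in>A. (a, x) \<in> r}) \<union> {(None, None)}"

text \<open>
  The sets \<open>D\<close> and \<open>I\<close> are only asked to be closed under passing to smaller and to larger points, an
  inclusion that is inherited by intersections at once.
\<close>

definition sup_open :: "'a topology \<Rightarrow> 'a rel \<Rightarrow> 'a set \<Rightarrow> 'a option set \<Rightarrow> bool" where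
  "sup_open X r A W \<longleftrightarrow>
     openin X (Some -` W) \<and>
     (None \<in> W \<longrightarrow>
       (\<exists>D I. openin X D \<and> r\<inverse> `` D \<subseteq> D \<and> A \<subseteq> D \<and> openin X I \<and> r `` I \<subseteq> I \<and> A \<inter> I \<noteq> {} \<and>
          D \<inter> I \<subseteq> Some -` W))"

definition sup_topology :: "'a topology \<Rightarrow> 'a rel \<Rightarrow> 'a set \<Rightarrow> 'a option topology" where
  "sup_topology X r A = topology (sup_open X r A)"

lemma sup_open_vimage: "sup_open X r A W \<Longrightarrow> openin X (Some -` W)"
  by (simp add: sup_open_def)

lemma sup_open_None:
  assumes "sup_open X r A W" "None \<in> W"
  obtains D I where "openin X D" "r\<inverse> `` D \<subseteq> D" "A \<subseteq> D" "openin X I" "r `` I \<subseteq> I" "A \<inter> I \<noteq> {}"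
    "D \<inter> I \<subseteq> Some -` W"
  using assms unfolding sup_open_def by blast

lemma sup_order_simps [simp]:
  "(Some x, Some y) \<in> sup_order r A \<longleftrightarrow> (x, y) \<in> r"
  "(Some x, None) \<in> sup_order r A \<longleftrightarrow> x \<in> r\<inverse> `` A"
  "(None, Some x) \<in> sup_order r A \<longleftrightarrow> (\<forall>a\<in>A. (a, x) \<in> r)"
  "(None, None) \<in> sup_order r A"
  by (auto simp: sup_order_def)

text \<open>
  The chain property of \<open>A\<close> is what makes the neighbourhoods of the new point a filter: two increasing
  sets that meet \<open>A\<close>, in \<open>a\<close> and in \<open>b\<close>, have the larger of \<open>a\<close> and \<open>b\<close> in common.
\<close>

lemma openin_sup_topology:
  assumes A: "A \<in> Chains r"
  shows "openin (sup_topology X r A) W \<longleftrightarrow> sup_open X r A W"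
proof -
  have "istopology (sup_open X r A)"
    unfolding istopology_def
  proof (intro conjI allI impI)
    fix S T assume S: "sup_open X r A S" and T: "sup_open X r A T"
    have "openin X (Some -` (S \<inter> T))"
      unfolding vimage_Int by (intro openin_Int sup_open_vimage [OF S] sup_open_vimage [OF T])
    moreover have "\<exists>D I. openin X D \<and> r\<inverse> `` D \<subseteq> D \<and> A \<subseteq> D \<and> openin X I \<and> r `` I \<subseteq> I \<and>
        A \<inter> I \<noteq> {} \<and> D \<inter> I \<subseteq> Some -` (S \<inter> T)" if N: "None \<in> S \<inter> T"
    proof -
      have None: "None \<in> S" "None \<in> T" using N by auto
      obtain D I where 1: "openin X D" "r\<inverse> `` D \<subseteq> D" "A \<subseteq> D" "openin X I" "r `` I \<subseteq> I"
          "A \<inter> I \<noteq> {}" "D \<inter> I \<subseteq> Some -` S"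
        by (rule sup_open_None [OF S None(1)])
      obtain D' I' where 2: "openin X D'" "r\<inverse> `` D' \<subseteq> D'" "A \<subseteq> D'" "openin X I'" "r `` I' \<subseteq> I'"
          "A \<inter> I' \<noteq> {}" "D' \<inter> I' \<subseteq> Some -` T"
        by (rule sup_open_None [OF T None(2)])
      obtain a b where ab: "a \<in> A" "a \<in> I" "b \<in> A" "b \<in> I'" using 1(6) 2(6) by blast
      then have "(a, b) \<in> r \<or> (b, a) \<in> r" using A by (auto simp: Chains_def)
      then have "a \<in> I' \<or> b \<in> I" using ab 1(5) 2(5) by blast
      then have "A \<inter> (I \<inter> I') \<noteq> {}" using ab by blast
      moreover have "r\<inverse> `` (D \<inter> D') \<subseteq> D \<inter> D'" using 1(2) 2(2) by blast
      moreover have "r `` (I \<inter> I') \<subseteq> I \<inter> I'" using 1(5) 2(5) by blast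
      moreover have "A \<subseteq> D \<inter> D'" using 1(3) 2(3) by blast
      moreover have "(D \<inter> D') \<inter> (I \<inter> I') \<subseteq> Some -` (S \<inter> T)" using 1(7) 2(7) by blast
      ultimately show ?thesis
        using openin_Int [OF 1(1) 2(1)] openin_Int [OF 1(4) 2(4)] by meson
    qed
    ultimately show "sup_open X r A (S \<inter> T)" by (simp add: sup_open_def)
  next
    fix K assume K: "\<forall>S\<in>K. sup_open X r A S"
    have "openin X (\<Union>S\<in>K. Some -` S)"
      using K by (intro openin_Union) (auto intro: sup_open_vimage)
    moreover have "\<exists>D I. openin X D \<and> r\<inverse> `` D \<subseteq> D \<and> A \<subseteq> D \<and> openin X I \<and> r `` I \<subseteq> I \<and>
        A \<inter> I \<noteq> {} \<and> D \<inter> I \<subseteq> Some -` \<Union>K" if None: "None \<in> \<Union>K"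
    proof -
      obtain S where S: "S \<in> K" "None \<in> S" using None by blast
      then obtain D I where "openin X D" "r\<inverse> `` D \<subseteq> D" "A \<subseteq> D" "openin X I" "r `` I \<subseteq> I"
          "A \<inter> I \<noteq> {}" "D \<inter> I \<subseteq> Some -` S"
        using K by (meson sup_open_None)
      moreover from this have "D \<inter> I \<subseteq> Some -` \<Union>K" using S(1) by blast
      ultimately show ?thesis by blast
    qed
    ultimately show "sup_open X r A (\<Union>K)" by (simp add: sup_open_def vimage_Union)
  qed
  then show ?thesis by (simp add: sup_topology_def)
qed

lemma openin_sup_topology_Some:
  "A \<in> Chains r \<Longrightarrow> openin X U \<Longrightarrow> openin (sup_topology X r A) (Some ` U)"
  by (auto simp: openin_sup_topology sup_open_def inj_vimage_image_eq)

lemma openin_sup_topology_nhd: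
  assumes "A \<in> Chains r" "openin X D" "r\<inverse> `` D \<subseteq> D" "A \<subseteq> D" "openin X I" "r `` I \<subseteq> I" "A \<inter> I \<noteq> {}"
  shows "openin (sup_topology X r A) (insert None (Some ` (D \<inter> I)))"
proof -
  have "Some -` insert None (Some ` (D \<inter> I)) = D \<inter> I" by auto
  then show ?thesis
    unfolding openin_sup_topology [OF assms(1)] sup_open_def
    using assms openin_Int [OF assms(2,5)] by (metis order_refl)
qed

lemma openin_sup_topology_decreasing:
  assumes "pospace X r" "A \<in> Chains r" "A \<noteq> {}" "openin X D" "r\<inverse> `` D \<subseteq> D" "A \<subseteq> D"
  shows "openin (sup_topology X r A) (insert None (Some ` D))"
proof -
  have "A \<inter> topspace X \<noteq> {}" using chain_subset_topspace [OF assms(1,2)] assms(3) by blast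
  moreover have "r `` topspace X \<subseteq> topspace X" using pospace_carrier(2) [OF assms(1)] by auto
  moreover have "D \<inter> topspace X = D" using openin_subset [OF assms(4)] by blast
  ultimately show ?thesis
    using openin_sup_topology_nhd [OF assms(2,4,5,6) openin_topspace] by simp
qed

lemma openin_sup_topology_increasing:
  assumes "pospace X r" "A \<in> Chains r" "openin X I" "r `` I \<subseteq> I" "A \<inter> I \<noteq> {}"
  shows "openin (sup_topology X r A) (insert None (Some ` I))"
proof -
  have "A \<subseteq> topspace X" using chain_subset_topspace [OF assms(1,2)] .
  moreover have "r\<inverse> `` topspace X \<subseteq> topspace X" using pospace_carrier(1) [OF assms(1)] by auto
  moreover have "topspace X \<inter> I = I" using openin_subset [OF assms(3)] by blast
  ultimately show ?thesis
    using openin_sup_topology_nhd [OF assms(2) openin_topspace _ _ assms(3,4,5)] by simp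
qed

lemma topspace_sup_topology:
  assumes P: "pospace X r" and A: "A \<in> Chains r" "A \<noteq> {}"
  shows "topspace (sup_topology X r A) = insert None (Some ` topspace X)"
proof
  have "openin X (Some -` topspace (sup_topology X r A))"
    using openin_topspace [of "sup_topology X r A"]
    unfolding openin_sup_topology [OF A(1)] by (simp add: sup_open_def)
  then have "Some -` topspace (sup_topology X r A) \<subseteq> topspace X" by (rule openin_subset)
  then have "x \<in> topspace X" if "Some x \<in> topspace (sup_topology X r A)" for x
    using that by auto
  then show "topspace (sup_topology X r A) \<subseteq> insert None (Some ` topspace X)"
    by (metis image_eqI insertCI option.exhaust subsetI)
  have "r\<inverse> `` topspace X \<subseteq> topspace X" using pospace_carrier(1) [OF P] by auto
  then have "openin (sup_topology X r A) (insert None (Some ` topspace X))"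
    using openin_sup_topology_decreasing [OF P A openin_topspace] chain_subset_topspace [OF P A(1)]
    by simp
  then show "insert None (Some ` topspace X) \<subseteq> topspace (sup_topology X r A)"
    by (rule openin_subset)
qed

text \<open>
  Antisymmetry is where \<open>A\<close> must lack a greatest element: a point of the down-set of \<open>A\<close> that is also
  an upper bound of \<open>A\<close> would be such an element.
\<close>

lemma partial_order_sup_order:
  assumes P: "pospace X r" and ne: "A \<noteq> {}"
    and nomax: "\<And>m. m \<in> A \<Longrightarrow> \<exists>a\<in>A. (a, m) \<notin> r"
  shows "partial_order_on (insert None (Some ` topspace X)) (sup_order r A)"
proof -
  have rX: "x \<in> topspace X \<and> y \<in> topspace X" if "(x, y) \<in> r" for x y
    using pospace_carrier [OF P that] by blast
  have "sup_order r A \<subseteq> insert None (Some ` topspace X) \<times> insert None (Some ` topspace X)"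
    using rX ne by (fastforce simp: sup_order_def)
  then have "refl_on (insert None (Some ` topspace X)) (sup_order r A) \<and>
    sup_order r A \<subseteq> insert None (Some ` topspace X) \<times> insert None (Some ` topspace X)"
    using pospace_refl [OF P] by (auto simp: refl_on_def)
  moreover have "trans (sup_order r A)"
  proof (rule transI)
    fix p q s
    have "(p, q) \<in> sup_order r A \<longrightarrow> (q, s) \<in> sup_order r A \<longrightarrow> (p, s) \<in> sup_order r A"
      by (cases p; cases q; cases s; simp add: Image_iff; meson pospace_trans [OF P])
    then show "(p, q) \<in> sup_order r A \<Longrightarrow> (q, s) \<in> sup_order r A \<Longrightarrow> (p, s) \<in> sup_order r A"
      by blast
  qed
  moreover have "antisym (sup_order r A)"
  proof (rule antisymI)
    have gap: False if x: "x \<in> r\<inverse> `` A" "\<forall>a\<in>A. (a, x) \<in> r" for x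
    proof -
      obtain m where m: "m \<in> A" "(x, m) \<in> r" using x(1) by blast
      then show False using nomax [OF m(1)] x(2) pospace_trans [OF P] by blast
    qed
    fix p q assume "(p, q) \<in> sup_order r A" "(q, p) \<in> sup_order r A"
    then show "p = q"
      using pospace_antisym [OF P] gap by (cases p; cases q) auto
  qed
  ultimately show ?thesis by (simp add: order_on_defs)
qed

text \<open>
  Two points of \<open>X\<close> are separated as before. If \<open>x\<close> is not below the new point, it is outside the
  closed decreasing set generated by \<open>A\<close>, and lower regularity provides an increasing neighbourhood
  of \<open>x\<close> disjoint from a set \<open>D\<close>. If \<open>x\<close> is not above the new point, it is outside the closed increasing
  set generated by some \<open>a \<in> A\<close>, and upper regularity provides a decreasing neighbourhood of \<open>x\<close>
  disjoint from a set \<open>I\<close>. Monotonicity of the disjoint sets excludes all relations between them.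
\<close>

lemma pospace_sup:
  assumes P: "pospace X r" and reg: "regularly_ordered X r"
    and A: "A \<in> Chains r" "A \<noteq> {}" and cl: "closedin X (r\<inverse> `` A)"
    and nomax: "\<And>m. m \<in> A \<Longrightarrow> \<exists>a\<in>A. (a, m) \<notin> r"
  shows "pospace (sup_topology X r A) (sup_order r A)"
proof (rule pospaceI)
  let ?Z = "sup_topology X r A" and ?t = "sup_order r A"
  note top = topspace_sup_topology [OF P A]
  show po: "partial_order_on (topspace ?Z) ?t"
    unfolding top using P A(2) nomax by (rule partial_order_sup_order)
  show "?t \<subseteq> topspace ?Z \<times> topspace ?Z"
    using po by (simp add: order_on_defs)
  have AX: "A \<subseteq> topspace X" by (rule chain_subset_topspace [OF P A(1)])
  fix p q assume p: "p \<in> topspace ?Z" and q: "q \<in> topspace ?Z" and pq: "(p, q) \<notin> ?t"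
  consider (old) x z where "p = Some x" "q = Some z"
    | (above) x where "p = Some x" "q = None"
    | (below) x where "p = None" "q = Some x"
    using pq by (cases p; cases q) auto
  then show "\<exists>U V. openin ?Z U \<and> openin ?Z V \<and> p \<in> U \<and> q \<in> V \<and> U \<times> V \<inter> ?t = {}"
  proof cases
    case old
    then obtain U V where "openin X U" "openin X V" "x \<in> U" "z \<in> V" "U \<times> V \<inter> r = {}"
      using pospace_separate [OF P, of x z] p q pq by (auto simp: top)
    then show ?thesis
      using openin_sup_topology_Some [OF A(1)] old
      by (intro exI [of _ "Some ` U"] exI [of _ "Some ` V"]) auto
  next
    case above
    have "decreasing_in r (r\<inverse> `` A)"
      using pospace_trans [OF P] pospace_refl [OF P] pospace_carrier [OF P]
      unfolding decreasing_in_def by fast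
    moreover have "x \<in> topspace X - r\<inverse> `` A" using above p pq by (auto simp: top)
    ultimately obtain U V where UV: "openin X U" "openin X V" "x \<in> U" "r\<inverse> `` A \<subseteq> V" "disjnt U V"
        "increasing_in r U" "decreasing_in r V"
      using reg cl unfolding regularly_ordered_def lower_regularly_ordered_def by meson
    have AV: "A \<subseteq> V" using UV(4) AX pospace_refl [OF P] by blast
    have rV: "r\<inverse> `` V \<subseteq> V" using UV(7) by (simp add: decreasing_in_def)
    have "Some ` U \<times> insert None (Some ` V) \<inter> ?t = {}"
      using UV(4,5) rV by (fastforce simp: disjnt_iff)
    then show ?thesis
      using openin_sup_topology_Some [OF A(1) UV(1)] UV(3) above
        openin_sup_topology_decreasing [OF P A UV(2) rV AV] by blast
  next
    case below
    obtain a where a: "a \<in> A" "(a, x) \<notin> r" using below pq by auto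
    have "increasing_in r (r `` {a})"
      using pospace_trans [OF P] pospace_refl [OF P] pospace_carrier [OF P]
      unfolding increasing_in_def by blast
    moreover have "x \<in> topspace X - r `` {a}" using below q a by (auto simp: top)
    ultimately obtain U V where UV: "openin X U" "openin X V" "x \<in> U" "r `` {a} \<subseteq> V" "disjnt U V"
        "decreasing_in r U" "increasing_in r V"
      using reg closedin_up_point [OF P, of a]
      unfolding regularly_ordered_def upper_regularly_ordered_def by meson
    have AV: "A \<inter> V \<noteq> {}" using UV(4) a(1) AX pospace_refl [OF P] by blast
    have rV: "r `` V \<subseteq> V" using UV(7) by (simp add: increasing_in_def)
    have "insert None (Some ` V) \<times> Some ` U \<inter> ?t = {}"
      using UV(4,5) rV a(1) by (fastforce simp: disjnt_iff)
    then show ?thesis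
      using openin_sup_topology_Some [OF A(1) UV(1)] UV(3) below
        openin_sup_topology_increasing [OF P A(1) UV(2) rV AV] by blast
  qed
qed

lemma pospace_embedding_sup:
  assumes P: "pospace X r" and A: "A \<in> Chains r" "A \<noteq> {}"
  shows "pospace_embedding X r (sup_topology X r A) (sup_order r A) Some"
proof -
  note top = topspace_sup_topology [OF P A]
  have "open_map X (sup_topology X r A) Some"
    by (simp add: open_map_def openin_sup_topology_Some [OF A(1)])
  moreover have "continuous_map X (sup_topology X r A) Some"
    unfolding continuous_map_def
  proof (intro conjI allI impI)
    show "Some \<in> topspace X \<rightarrow> topspace (sup_topology X r A)" by (auto simp: top)
    fix W assume "openin (sup_topology X r A) W"
    then have W: "openin X (Some -` W)" by (simp add: openin_sup_topology [OF A(1)] sup_open_def)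
    then have "{x \<in> topspace X. Some x \<in> W} = Some -` W" using openin_subset by fastforce
    with W show "openin X {x \<in> topspace X. Some x \<in> W}" by simp
  qed
  ultimately have "embedding_map X (sup_topology X r A) Some"
    by (intro injective_open_imp_embedding_map) auto
  then show ?thesis by (simp add: pospace_embedding_def)
qed

text \<open>
  The new point is never isolated: a set \<open>D\<close> that contains \<open>A\<close> and a set \<open>I\<close> that meets \<open>A\<close> have a
  point in common.
\<close>

lemma not_closedin_sup:
  assumes P: "pospace X r" and A: "A \<in> Chains r" "A \<noteq> {}"
  shows "\<not> closedin (sup_topology X r A) (Some ` topspace X)"
proof
  assume "closedin (sup_topology X r A) (Some ` topspace X)"
  moreover have "topspace (sup_topology X r A) - Some ` topspace X = {None}"
    by (auto simp: topspace_sup_topology [OF P A])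
  ultimately have "openin (sup_topology X r A) {None}" by (simp add: closedin_def)
  then show False by (auto simp: openin_sup_topology [OF A(1)] sup_open_def)
qed

section \<open>Closed chains in H-closed pospaces\<close>

text \<open>
  Otherwise the extension by a supremum of \<open>A\<close> is a pospace in which \<open>X\<close> is not closed.
\<close>

lemma chain_has_greatest:
  fixes X :: "'a topology"
  assumes H: "H_closed_pospace TYPE('a option) X r" and reg: "regularly_ordered X r"
    and A: "A \<in> Chains r" "A \<noteq> {}" and cl: "closedin X (r\<inverse> `` A)"
  shows "\<exists>m\<in>A. \<forall>a\<in>A. (a, m) \<in> r"
proof (rule ccontr)
  assume "\<not> ?thesis"
  then have nomax: "\<And>m. m \<in> A \<Longrightarrow> \<exists>a\<in>A. (a, m) \<notin> r" by blast
  have P: "pospace X r" using H by (simp add: H_closed_pospace_def)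
  have "closedin (sup_topology X r A) (Some ` topspace X)"
    using H pospace_sup [OF P reg A cl nomax] pospace_embedding_sup [OF P A]
    by (auto simp: H_closed_pospace_def)
  with not_closedin_sup [OF P A] show False by contradiction
qed

lemma H_closed_pospace_converse:
  fixes T :: "'b itself"
  assumes "H_closed_pospace T X r"
  shows "H_closed_pospace T X (r\<inverse>)"
  unfolding H_closed_pospace_def
proof (intro conjI allI impI)
  show "pospace X (r\<inverse>)" using assms by (simp add: H_closed_pospace_def pospace_converse)
  fix Y :: "'b topology" and s f assume "pospace Y s \<and> pospace_embedding X (r\<inverse>) Y s f"
  then have "pospace Y (s\<inverse>) \<and> pospace_embedding X r Y (s\<inverse>) f"
    by (auto simp: pospace_converse pospace_embedding_def)
  then show "closedin Y (f ` topspace X)" using assms by (auto simp: H_closed_pospace_def)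
qed

lemma regularly_ordered_converse: "regularly_ordered X (r\<inverse>) \<longleftrightarrow> regularly_ordered X r"
  unfolding regularly_ordered_def upper_regularly_ordered_def lower_regularly_ordered_def
    increasing_in_def decreasing_in_def by auto

lemma chain_has_least:
  fixes X :: "'a topology"
  assumes H: "H_closed_pospace TYPE('a option) X r" and reg: "regularly_ordered X r"
    and B: "B \<in> Chains r" "B \<noteq> {}" and cl: "closedin X (r `` B)"
  shows "\<exists>m\<in>B. \<forall>b\<in>B. (m, b) \<in> r"
  using chain_has_greatest [OF H_closed_pospace_converse [OF H], of B] reg B cl
  by (simp add: regularly_ordered_converse Chains_converse)

text \<open>
  An extremum of the part of a chain that lies on one side of \<open>y\<close> captures \<open>y\<close> as soon as \<open>y\<close> is in
  the closure of that part; hence no chain with enough extrema can be enlarged by a limit point.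
\<close>

lemma H_closed_closed_chain:
  assumes P: "pospace X r" and L: "L \<in> Chains r" "closedin X L"
    and greatest: "\<And>A. A \<subseteq> L \<Longrightarrow> closedin X A \<Longrightarrow> A \<noteq> {} \<Longrightarrow> \<exists>m\<in>A. \<forall>a\<in>A. (a, m) \<in> r"
    and least: "\<And>B. B \<subseteq> L \<Longrightarrow> closedin X B \<Longrightarrow> B \<noteq> {} \<Longrightarrow> \<exists>m\<in>B. \<forall>b\<in>B. (m, b) \<in> r"
  shows "H_closed_pospace TYPE('b) (subtopology X L) (r \<inter> L \<times> L)"
  unfolding H_closed_pospace_def
proof (intro conjI allI impI)
  have LX: "L \<subseteq> topspace X" by (rule chain_subset_topspace [OF P L(1)])
  then have top: "topspace (subtopology X L) = L" by auto
  show "pospace (subtopology X L) (r \<inter> L \<times> L)" by (rule pospace_subtopology [OF P LX])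
  fix Y :: "'b topology" and s f
  assume "pospace Y s \<and> pospace_embedding (subtopology X L) (r \<inter> L \<times> L) Y s f"
  then have Q: "pospace Y s" and emb: "embedding_map (subtopology X L) Y f"
    and ord: "\<And>x y. x \<in> L \<Longrightarrow> y \<in> L \<Longrightarrow> (f x, f y) \<in> s \<longleftrightarrow> (x, y) \<in> r"
    unfolding pospace_embedding_def top by auto
  have contf: "continuous_map (subtopology X L) Y f"
    using emb homeomorphic_imp_continuous_map continuous_map_into_fulltopology
    unfolding embedding_map_def by blast
  then have fL: "f ` L \<subseteq> topspace Y" using top by (auto simp: continuous_map_def)
  have preimage: "closedin X {l \<in> L. f l \<in> C}" if "closedin Y C" for C
    using closedin_continuous_map_preimage [OF contf that] L(2)
    unfolding top by (simp add: closedin_closed_subtopology)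
  have "Y closure_of (f ` L) \<subseteq> f ` L"
  proof
    fix y assume y: "y \<in> Y closure_of (f ` L)"
    define A where "A = {l \<in> L. f l \<in> s\<inverse> `` {y}}"
    define B where "B = {l \<in> L. f l \<in> s `` {y}}"
    have clA: "closedin X A" and clB: "closedin X B"
      unfolding A_def B_def by (intro preimage closedin_up_point closedin_down_point Q)+
    have "(f l, y) \<in> s \<or> (y, f l) \<in> s" if l: "l \<in> L" for l
    proof -
      have "Y closure_of (f ` L) \<subseteq> s `` {f l} \<union> s\<inverse> `` {f l}"
      proof (rule closure_of_minimal)
        show "f ` L \<subseteq> s `` {f l} \<union> s\<inverse> `` {f l}"
          using L(1) l ord unfolding Chains_def by blast
        show "closedin Y (s `` {f l} \<union> s\<inverse> `` {f l})"
          by (intro closedin_Un closedin_up_point closedin_down_point Q)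
      qed
      then show ?thesis using y by auto
    qed
    then have "L = A \<union> B" by (auto simp: A_def B_def)
    then have "y \<in> Y closure_of (f ` A) \<union> Y closure_of (f ` B)"
      using y by (simp add: image_Un closure_of_Un)
    then show "y \<in> f ` L"
    proof
      assume yA: "y \<in> Y closure_of (f ` A)"
      then have "A \<noteq> {}" by auto
      then obtain m where m: "m \<in> A" "\<forall>a\<in>A. (a, m) \<in> r"
        using greatest [OF _ clA] by (auto simp: A_def)
      have "Y closure_of (f ` A) \<subseteq> s\<inverse> `` {f m}"
        using m ord by (intro closure_of_minimal closedin_down_point Q) (auto simp: A_def)
      then have "y = f m"
        using yA m(1) pospace_antisym [OF Q] by (auto simp: A_def)
      then show ?thesis using m(1) by (auto simp: A_def)
    next
      assume yB: "y \<in> Y closure_of (f ` B)"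
      then have "B \<noteq> {}" by auto
      then obtain m where m: "m \<in> B" "\<forall>b\<in>B. (m, b) \<in> r"
        using least [OF _ clB] by (auto simp: B_def)
      have "Y closure_of (f ` B) \<subseteq> s `` {f m}"
        using m ord by (intro closure_of_minimal closedin_up_point Q) (auto simp: B_def)
      then have "y = f m"
        using yB m(1) pospace_antisym [OF Q] by (auto simp: B_def)
      then show ?thesis using m(1) by (auto simp: B_def)
    qed
  qed
  then have "closedin Y (f ` L)" using closure_of_subset_eq [of "f ` L" Y] fL by blast
  then show "closedin Y (f ` topspace (subtopology X L))" unfolding top .
qed

theorem theorem4p10:
  fixes X :: "'a topology" and r :: "'a rel" and L :: "'a set"
  assumes "H_closed_pospace TYPE('a option) X r"
    and "regularly_ordered X r"
    and "CC_i_space X r"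
    and "CC_d_space X r"
    and "maximal_chain r L"
    and "updown_m_property (topspace X) r L"
  shows "H_closed_pospace TYPE('b) (subtopology X L) (r \<inter> L \<times> L)"
proof (rule H_closed_closed_chain)
  show P: "pospace X r" using assms(1) by (simp add: H_closed_pospace_def)
  show L: "L \<in> Chains r" using assms(5) by (simp add: maximal_chain_def)
  show "closedin X L" by (rule closedin_maximal_chain [OF P assms(5)])
next
  fix A assume A: "A \<subseteq> L" "closedin X A" "A \<noteq> {}"
  have "A \<in> Chains r" using assms(5) A(1) chain_subset unfolding maximal_chain_def by blast
  then show "\<exists>m\<in>A. \<forall>a\<in>A. (a, m) \<in> r"
    using chain_has_greatest [OF assms(1,2) _ A(3)] assms(4) A(2) by (simp add: CC_d_space_def)
next
  fix B assume B: "B \<subseteq> L" "closedin X B" "B \<noteq> {}"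
  have "B \<in> Chains r" using assms(5) B(1) chain_subset unfolding maximal_chain_def by blast
  then show "\<exists>m\<in>B. \<forall>b\<in>B. (m, b) \<in> r"
    using chain_has_least [OF assms(1,2) _ B(3)] assms(3) B(2) by (simp add: CC_i_space_def)
qed

end
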